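(* Let $n,N\ge1$ be integers and let $f$ be a real-valued function on $\breve F_N^n$. For $\mathbf m\in\breve D_N^n$ put $$a_{\mathbf m}=N^{-n}|S_{\mathbf m}|^{-1}r_{\mathbf m}^{-1}|S_n|\sum_{\mathbf s\in\breve F_N^n}|S_{\mathbf s}|^{-1}c_{\mathbf s}f(\mathbf s)\cos^+_{\mathbf m}(\mathbf s).$$ Then for all $\mathbf s\in\breve F_N^n$ $$f(\mathbf s)=\sum_{\mathbf m\in\breve D_N^n}a_{\mathbf m}\cos^+_{\mathbf m}(\mathbf s).$$
   Context: $F_N=\{0,\frac1N,\frac2N,\dots,\frac{N-1}N,1\}$; $\breve F_N^n$ is the set of $\mathbf s=(s_1,\dots,s_n)\in F_N^n$ with $s_1\ge s_2\ge\cdots\ge s_n$; $\breve D_N^n$ is the set of integer $n$-tuples $\mathbf m$ with $N\ge m_1\ge m_2\ge\cdots\ge m_n\ge0$. $S_n$ is the symmetric group, $|S_n|=n!$; for an $n$-tuple $\mathbf t$, $S_{\mathbf t}\subset S_n$ is the subgroup of permutations leaving $\mathbf t$ invariant and $|S_{\mathbf t}|$ its order. $\cos^+_{\mathbf m}(\mathbf s)=|S_n|^{-1/2}\sum_{w\in S_n}\prod_{j=1}^n\cos(\pi m_{w(j)}s_j)$. $c_{\mathbf s}=c_{s_1}\cdots c_{s_n}$ with $c_s=\frac12$ for $s\in\{0,1\}$ and $c_s=1$ otherwise; $r_{\mathbf m}=r_{m_1}\cdots r_{m_n}$ with $r_m=1$ for $m\in\{0,N\}$ and $r_m=\frac12$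 otherwise. *)

theory Defs
  imports Complex_Main "HOL-Library.FuncSet" "HOL-Combinatorics.Permutations"
begin

text \<open>
  An \<open>n\<close>-tuple is a function on the index set \<open>{1..n}\<close>, extensional outside of it (as in
  \<^const>\<open>PiE\<close>), so that equality of functions is equality of tuples and sets of tuples have the
  expected cardinality.
\<close>

definition grid :: "nat \<Rightarrow> real set" where
  "grid N = {real k / real N | k. k \<le> N}"

definition decreasing_tuple :: "nat \<Rightarrow> (nat \<Rightarrow> 'a::linorder) \<Rightarrow> bool" where
  "decreasing_tuple n t \<longleftrightarrow> (\<forall>i\<in>{1..n}. \<forall>j\<in>{1..n}. i \<le> j \<longrightarrow> t i \<ge> t j)"

definition F_dom :: "nat \<Rightarrow> nat \<Rightarrow> (nat \<Rightarrow> real) set" where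
  "F_dom N n = {s \<in> {1..n} \<rightarrow>\<^sub>E grid N. decreasing_tuple n s}"

definition D_dom :: "nat \<Rightarrow> nat \<Rightarrow> (nat \<Rightarrow> int) set" where
  "D_dom N n = {m \<in> {1..n} \<rightarrow>\<^sub>E {0..int N}. decreasing_tuple n m}"

definition perm_group :: "nat \<Rightarrow> (nat \<Rightarrow> nat) set" where
  "perm_group n = {w. w permutes {1..n}}"

definition stab :: "nat \<Rightarrow> (nat \<Rightarrow> 'a) \<Rightarrow> (nat \<Rightarrow> nat) set" where
  "stab n t = {w \<in> perm_group n. \<forall>i\<in>{1..n}. t (w i) = t i}"

definition cos_plus :: "nat \<Rightarrow> (nat \<Rightarrow> int) \<Rightarrow> (nat \<Rightarrow> real) \<Rightarrow> real" where
  "cos_plus n m s = 1 / sqrt (real (card (perm_group n))) *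
     (\<Sum>w\<in>perm_group n. \<Prod>j=1..n. cos (pi * real_of_int (m (w j)) * s j))"

definition c_one :: "real \<Rightarrow> real" where
  "c_one s = (if s = 0 \<or> s = 1 then 1/2 else 1)"

definition c_tuple :: "nat \<Rightarrow> (nat \<Rightarrow> real) \<Rightarrow> real" where
  "c_tuple n s = (\<Prod>j=1..n. c_one (s j))"

definition r_one :: "nat \<Rightarrow> int \<Rightarrow> real" where
  "r_one N m = (if m = 0 \<or> m = int N then 1 else 1/2)"

definition r_tuple :: "nat \<Rightarrow> nat \<Rightarrow> (nat \<Rightarrow> int) \<Rightarrow> real" where
  "r_tuple N n m = (\<Prod>j=1..n. r_one N (m j))"

definition coeff_a :: "nat \<Rightarrow> nat \<Rightarrow> ((nat \<Rightarrow> real) \<Rightarrow> real) \<Rightarrow> (nat \<Rightarrow> int) \<Rightarrow> real" where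
  "coeff_a N n f m =
     inverse (real N ^ n) * inverse (real (card (stab n m))) * inverse (r_tuple N n m) *
     real (card (perm_group n)) *
     (\<Sum>s\<in>F_dom N n. inverse (real (card (stab n s))) * c_tuple n s * f s * cos_plus n m s)"

end

theory Submission
  imports Defs
begin

text \<open>
  Over all of \<open>{0..N}\<^sup>n\<close>, the kernel of the product cosine transform factors into one-dimensional
  kernels, which are orthogonal by the closed form of the trapezoidal Dirichlet sum. Every tuple is
  a rearrangement of exactly one decreasing tuple \<open>m\<close>, in \<open>|S\<^sub>m|\<close> ways, so a sum of a symmetric function
  over all tuples is \<open>n!\<close> times its sum over decreasing tuples weighted by \<open>|S\<^sub>m|\<^sup>-\<^sup>1\<close>; symmetrizing
  the product kernel then leaves \<open>|S\<^sub>s|\<close> copies of the diagonal term.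
\<close>

section \<open>One-dimensional discrete cosine orthogonality\<close>

text \<open>Multiplying by \<open>sin (x/2)\<close> makes the trapezoidal sum telescope. Keeping it
  as a factor instead of dividing leaves the identity valid where it vanishes.\<close>

lemma trapezoid_cos_sum:
  fixes x :: real
  shows "sin (x/2) * (1 + 2 * (\<Sum>m=1..M. cos (real m * x)) + cos (real (Suc M) * x))
    = cos (x/2) * sin (real (Suc M) * x)"
proof (induction M)
  case 0
  show ?case
    using cos_double_cos[of "x/2"] sin_double[of "x/2"] by (simp add: power2_eq_square)
next
  case (Suc M)
  define y where "y = real (Suc M) * x"
  \<comment> \<open>Rewriting around the midpoint \<open>y + x/2\<close> turns both increments of
    the induction step into \<open>2 * sin (x/2) * cos (x/2) * cos (y + x/2)\<close>.\<close>
  have a: "cos y = cos ((y + x/2) - x/2)" "cos (y + x) = cos ((y + x/2) + x/2)"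
     "sin y = sin ((y + x/2) - x/2)" "sin (y + x) = sin ((y + x/2) + x/2)"
    by (simp_all add: algebra_simps)
  have step: "sin (x/2) * (cos y + cos (y + x)) = cos (x/2) * (sin (y + x) - sin y)"
    unfolding a by (simp only: cos_add cos_diff sin_add sin_diff) (simp add: algebra_simps)
  have y': "real (Suc (Suc M)) * x = y + x" by (simp add: y_def algebra_simps)
  have "(\<Sum>m=1..Suc M. cos (real m * x)) = (\<Sum>m=1..M. cos (real m * x)) + cos y"
    by (simp add: y_def)
  then show ?case
    using Suc.IH step unfolding y' y_def[symmetric] by (simp add: algebra_simps)
qed

text \<open>The weights are 1 at both ends and 2 in between, so this is the trapezoidal sum at
  \<open>x = pi * k / N\<close>, where \<open>sin (N * x)\<close> vanishes. Hence the sum is zero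
  unless \<open>sin (x/2) = 0\<close>, that is, unless \<open>2 * N\<close> divides
  \<open>k\<close>; then every cosine is 1 and the weights add up to \<open>2 * N\<close>.\<close>

lemma sum_r_one_cos:
  fixes k :: int
  assumes N: "N \<ge> 1"
  shows "(\<Sum>m\<in>{0..int N}. inverse (r_one N m) * cos (pi * real_of_int m * (real_of_int k / real N)))
    = (if 2 * int N dvd k then 2 * real N else 0)"
proof -
  define x where "x = pi * real_of_int k / real N"
  obtain M where M: "N = Suc M" using N by (cases N) auto
  have "(\<Sum>m\<in>{0..int N}. inverse (r_one N m) * cos (pi * real_of_int m * (real_of_int k / real N)))
    = (\<Sum>m\<in>{0..N}. inverse (r_one N (int m)) * cos (real m * x))"
    by (rule sum.reindex_bij_witness[of _ int nat]) (auto simp: x_def mult_ac)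
  also have "\<dots> = 1 + (\<Sum>m=1..M. inverse (r_one N (int m)) * cos (real m * x)) + cos (real N * x)"
    by (simp add: M sum.atLeast_Suc_atMost[of 0] r_one_def)
  also have "(\<Sum>m=1..M. inverse (r_one N (int m)) * cos (real m * x))
      = 2 * (\<Sum>m=1..M. cos (real m * x))"
    by (simp add: sum_distrib_left r_one_def M)
  finally have eq: "(\<Sum>m\<in>{0..int N}. inverse (r_one N m) * cos (pi * real_of_int m * (real_of_int k / real N)))
    = 1 + 2 * (\<Sum>m=1..M. cos (real m * x)) + cos (real N * x)" .
  show ?thesis
  proof (cases "2 * int N dvd k")
    case True
    then obtain q where q: "k = 2 * int N * q" by (auto simp: dvd_def)
    have "cos (real m * x) = 1" for m
    proof -
      have "real m * x = 2 * pi * real_of_int (int m * q)"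
        using N by (simp add: x_def q field_simps)
      then show ?thesis by (simp only: cos_int_2pin)
    qed
    then show ?thesis using True unfolding eq by (simp add: M del: of_nat_Suc) simp
  next
    case False
    have "sin (x/2) \<noteq> 0"
    proof
      assume "sin (x/2) = 0"
      then obtain q :: int where "x/2 = real_of_int q * pi"
        by (auto simp: sin_zero_iff_int2)
      then have "real_of_int k = real_of_int (2 * int N * q)"
        using N by (simp add: x_def field_simps)
      then have "k = 2 * int N * q" using of_int_eq_iff by blast
      then show False using False by simp
    qed
    moreover have "sin (real N * x) = 0"
      using N by (simp add: x_def sin_zero_iff_int2)
    ultimately show ?thesis
      using trapezoid_cos_sum[of x M] False unfolding eq by (simp add: M)
  qed
qed

lemma cos_orthogonality:
  assumes N: "N \<ge> 1" and s: "s \<in> grid N" and t: "t \<in> grid N"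
  shows "(\<Sum>m\<in>{0..int N}. inverse (r_one N m) *
      (cos (pi * real_of_int m * s) * cos (pi * real_of_int m * t)))
    = (if s = t then real N * inverse (c_one s) else 0)"
proof -
  obtain a b where a: "s = real a / real N" "a \<le> N" and b: "t = real b / real N" "b \<le> N"
    using s t by (auto simp: grid_def)
  \<comment> \<open>Product-to-sum reduces the claim to the frequencies \<open>a - b\<close> and
    \<open>a + b\<close>.\<close>
  have "inverse (r_one N m) * (cos (pi * real_of_int m * s) * cos (pi * real_of_int m * t))
     = (inverse (r_one N m) * cos (pi * real_of_int m * (real_of_int (int a - int b) / real N))
      + inverse (r_one N m) * cos (pi * real_of_int m * (real_of_int (int a + int b) / real N))) / 2" for m
    unfolding cos_times_cos a b by (simp add: divide_simps)
      (simp add: algebra_simps diff_divide_distrib add_divide_distrib)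
  then have "(\<Sum>m\<in>{0..int N}. inverse (r_one N m) *
      (cos (pi * real_of_int m * s) * cos (pi * real_of_int m * t)))
    = ((if 2 * int N dvd int a - int b then 2 * real N else 0)
       + (if 2 * int N dvd int a + int b then 2 * real N else 0)) / 2"
    by (simp only: sum_divide_distrib[symmetric] sum.distrib sum_r_one_cos[OF N])
  moreover have "2 * int N dvd int a - int b \<longleftrightarrow> a = b"
    using a b N dvd_imp_le_int[of "int a - int b" "2 * int N"] by (cases "a = b") auto
  \<comment> \<open>As \<open>a + b\<close> lies between 0 and \<open>2 * N\<close>, only the two
    extremes are multiples of \<open>2 * N\<close>. This second contribution doubles the norm
    exactly at the endpoints of the grid, which is the factor
    \<open>inverse (c_one s)\<close>.\<close>
  moreover have "2 * int N dvd int a + int b \<longleftrightarrow> (a = 0 \<and> b = 0) \<or> (a = N \<and> b = N)"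
    using a b N dvd_imp_le_int[of "int a + int b" "2 * int N"]
    by (cases "int a + int b = 0") auto
  ultimately show ?thesis
    using N a b by (auto simp: c_one_def)
qed

section \<open>Permutations acting on tuples\<close>

lemma finite_perm_group [simp]: "finite (perm_group n)"
  by (simp add: perm_group_def finite_permutations)

lemma card_perm_group: "card (perm_group n) = fact n"
  by (simp add: perm_group_def card_permutations)

lemma sum_perm_inv: "(\<Sum>w\<in>perm_group n. g (inv w)) = (\<Sum>w\<in>perm_group n. g w)"
  by (rule sum.reindex_bij_witness[of _ inv inv])
     (auto simp: perm_group_def permutes_inv permutes_inv_inv)

lemma sum_perm_compose_left:
  assumes "v \<in> perm_group n"
  shows "(\<Sum>w\<in>perm_group n. g (v \<circ> w)) = (\<Sum>w\<in>perm_group n. g w)"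
  using assms
  by (intro sum.reindex_bij_witness[of _ "\<lambda>w. inv v \<circ> w" "\<lambda>w. v \<circ> w"])
     (auto simp: perm_group_def permutes_inv permutes_compose permutes_inv_o o_assoc)

lemma prod_perm:
  assumes "w \<in> perm_group n"
  shows "(\<Prod>j=1..n. g (w j)) = (\<Prod>j=1..n. g j)"
  using assms prod.permute[of w "{1..n}" g] by (simp add: perm_group_def o_def)

text \<open>A permutation of \<open>{1..n}\<close> fixes all other indices, so composing with it
  keeps a tuple extensional.\<close>

lemma PiE_compose_perm:
  assumes "w \<in> perm_group n" "t \<in> {1..n} \<rightarrow>\<^sub>E A"
  shows "t \<circ> w \<in> {1..n} \<rightarrow>\<^sub>E A"
  using assms permutes_in_image[of w "{1..n}"] permutes_not_in[of w "{1..n}"]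
  unfolding perm_group_def PiE_def Pi_def extensional_def by force

lemma sum_PiE_compose_perm:
  assumes "w \<in> perm_group n"
  shows "(\<Sum>t\<in>{1..n} \<rightarrow>\<^sub>E A. g (t \<circ> w)) = (\<Sum>t\<in>{1..n} \<rightarrow>\<^sub>E A. g t)"
proof -
  have w: "w permutes {1..n}" and i: "inv w \<in> perm_group n"
    using assms by (auto simp: perm_group_def permutes_inv)
  show ?thesis
    by (rule sum.reindex_bij_witness[of _ "\<lambda>t. t \<circ> inv w" "\<lambda>t. t \<circ> w"])
       (simp_all only: PiE_compose_perm[OF assms] PiE_compose_perm[OF i]
          o_assoc[symmetric] permutes_inv_o[OF w] o_id)
qed

section \<open>Decreasing rearrangements and stabilizers\<close>

lemma sorted_rev_decreasing_tuple:
  assumes "decreasing_tuple n t"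
  shows "sorted (rev (map t [1..<Suc n]))"
  unfolding sorted_wrt_rev sorted_wrt_map
  by (rule sorted_wrt_mono_rel[OF _ sorted_wrt_upt])
     (use assms in \<open>auto simp: decreasing_tuple_def simp del: upt_Suc\<close>)

text \<open>Rearranging preserves the multiset of entries, and a sorted list is determined by its
  multiset. The lists are reversed because \<open>sorted\<close> means ascending.\<close>

lemma decreasing_rearrangement_unique:
  assumes "decreasing_tuple n t" "decreasing_tuple n u" and w: "w \<in> perm_group n"
    and eq: "\<And>i. i \<in> {1..n} \<Longrightarrow> u i = t (w i)" and i: "i \<in> {1..n}"
  shows "u i = t i"
proof -
  have "mset (map u [1..<Suc n]) = image_mset u (mset_set {1..n})"
    by (simp add: mset_set_upto_eq_mset_upto atLeastLessThanSuc_atLeastAtMost[symmetric] del: upt_Suc)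
  also have "\<dots> = image_mset t (image_mset w (mset_set {1..n}))"
    unfolding multiset.map_comp o_def by (rule image_mset_cong) (use eq in auto)
  also have "image_mset w (mset_set {1..n}) = mset_set {1..n}"
    using w by (simp add: perm_group_def permutes_image_mset)
  also have "image_mset t (mset_set {1..n}) = mset (map t [1..<Suc n])"
    by (simp add: mset_set_upto_eq_mset_upto atLeastLessThanSuc_atLeastAtMost[symmetric] del: upt_Suc)
  finally have "mset (rev (map u [1..<Suc n])) = mset (rev (map t [1..<Suc n]))" by simp
  then have "rev (map u [1..<Suc n]) = rev (map t [1..<Suc n])"
    by (metis assms(1,2) sorted_rev_decreasing_tuple properties_for_sort)
  then have "map u [1..<Suc n] = map t [1..<Suc n]" by (simp only: rev_is_rev_conv)
  then show ?thesis using i by (auto simp del: upt_Suc)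
qed

lemma decreasing_rearrangement_exists:
  fixes t :: "nat \<Rightarrow> 'a::linorder"
  shows "\<exists>w\<in>perm_group n. decreasing_tuple n (t \<circ> w)"
proof -
  define xs where "xs = map t [1..<Suc n]"
  define ys where "ys = rev (sort xs)"
  have len: "length xs = n" "length ys = n" by (simp_all add: xs_def ys_def)
  have "mset ys = mset xs" by (simp add: ys_def)
  then obtain p where p: "p permutes {..<n}" "permute_list p xs = ys"
    by (metis len(1) mset_eq_permutation)
  \<comment> \<open>\<open>p\<close> permutes list positions, which start at 0, while tuples are
    indexed from 1; \<open>w\<close> is \<open>p\<close> conjugated by the shift and extended by the
    identity.\<close>
  define w where "w = (\<lambda>i. if i \<in> {1..n} then Suc (p (i - 1)) else i)"
  have "bij_betw Suc {..<n} {1..n}"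
    by (rule bij_betw_byWitness[of _ "\<lambda>i. i - 1"]) auto
  moreover have "bij_betw (\<lambda>i. i - 1) {1..n} {..<n}"
    by (rule bij_betw_byWitness[of _ Suc]) auto
  ultimately have "bij_betw (Suc \<circ> (p \<circ> (\<lambda>i. i - 1))) {1..n} {1..n}"
    using permutes_imp_bij[OF p(1)] by (blast intro: bij_betw_trans)
  then have "bij_betw w {1..n} {1..n}"
    by (rule bij_betw_cong[THEN iffD1, rotated]) (simp add: w_def)
  then have w: "w \<in> perm_group n"
    unfolding perm_group_def mem_Collect_eq by (rule bij_imp_permutes) (simp only: w_def if_False)
  have nth: "t (w i) = ys ! (i - 1)" if "i \<in> {1..n}" for i
  proof -
    have "p (i - 1) < n" using permutes_in_image[OF p(1), of "i - 1"] that by auto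
    then show ?thesis
      using that p len by (auto simp: w_def xs_def permute_list_def simp del: upt_Suc)
  qed
  have "sorted_wrt (\<ge>) ys" by (simp add: ys_def sorted_wrt_rev)
  then have "t (w j) \<le> t (w i)" if "i \<in> {1..n}" "j \<in> {1..n}" "i \<le> j" for i j
    using that len sorted_wrt_nth_less[of "(\<ge>)" ys "i - 1" "j - 1"]
    by (cases "i = j") (auto simp: nth)
  then show ?thesis using w by (intro bexI[of _ w]) (auto simp: decreasing_tuple_def)
qed

text \<open>The permutations in question form the coset of the stabilizer obtained by composing with
  \<open>v\<close> on the right.\<close>

lemma card_rearrangements:
  assumes v: "v \<in> perm_group n" and t: "t \<in> {1..n} \<rightarrow>\<^sub>E A"
  shows "card {w \<in> perm_group n. t \<circ> w = t \<circ> v} = card (stab n t)"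
proof -
  have vp: "v permutes {1..n}" using v by (simp add: perm_group_def)
  \<comment> \<open>\<open>stab\<close> compares entries on \<open>{1..n}\<close> only; since
    permutations fix the other indices, this is equality of whole functions.\<close>
  have stab: "stab n t = {w \<in> perm_group n. t \<circ> w = t}"
  proof -
    have "(\<forall>i\<in>{1..n}. t (w i) = t i) \<longleftrightarrow> t \<circ> w = t" if "w \<in> perm_group n" for w
      using that permutes_not_in[of w "{1..n}"] by (fastforce simp: perm_group_def fun_eq_iff)
    then show ?thesis by (auto simp: stab_def)
  qed
  have "bij_betw (\<lambda>w. w \<circ> v) (stab n t) {w \<in> perm_group n. t \<circ> w = t \<circ> v}"
  proof (rule bij_betw_byWitness[of _ "\<lambda>w. w \<circ> inv v"])
    show "(\<lambda>w. w \<circ> v) ` stab n t \<subseteq> {w \<in> perm_group n. t \<circ> w = t \<circ> v}"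
      using vp by (auto simp: stab perm_group_def permutes_compose o_assoc)
    show "(\<lambda>w. w \<circ> inv v) ` {w \<in> perm_group n. t \<circ> w = t \<circ> v} \<subseteq> stab n t"
    proof clarsimp
      fix w assume w: "w \<in> perm_group n" "t \<circ> w = t \<circ> v"
      have "t \<circ> (w \<circ> inv v) = (t \<circ> v) \<circ> inv v" by (simp only: o_assoc w(2))
      also have "\<dots> = t" by (simp add: o_assoc[symmetric] permutes_inv_o[OF vp])
      finally show "w \<circ> inv v \<in> stab n t"
        using w vp by (auto simp: stab perm_group_def permutes_compose permutes_inv)
    qed
  qed (simp_all add: o_assoc[symmetric] permutes_inv_o[OF vp])
  then show ?thesis by (simp add: bij_betw_same_card)
qed

lemma stab_pos: "card (stab n t) > 0"
proof -
  have "id \<in> stab n t" by (simp add: stab_def perm_group_def permutes_id)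
  moreover have "finite (stab n t)" by (simp add: stab_def)
  ultimately show ?thesis by (auto simp: card_gt_0_iff)
qed

lemma decreasing_tuple_eqI:
  assumes "t \<in> {1..n} \<rightarrow>\<^sub>E A" "u \<in> {1..n} \<rightarrow>\<^sub>E B"
    and "decreasing_tuple n t" "decreasing_tuple n u" "w \<in> perm_group n"
    and "\<And>i. i \<in> {1..n} \<Longrightarrow> u i = t (w i)"
  shows "u = t"
  \<comment> \<open>The union serves as a common codomain for two tuples whose value sets may
    differ.\<close>
  by (rule PiE_ext[where k = "{1..n}" and s = "\<lambda>_. A \<union> B"])
     (use assms decreasing_rearrangement_unique[OF assms(3-6)] in \<open>auto simp: PiE_iff\<close>)

section \<open>Reduction of symmetric sums to decreasing tuples\<close>

text \<open>Double counting along the map \<open>(m, w) \<mapsto> m \<circ> w\<close> from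
  \<open>D \<times> perm_group n\<close> onto all tuples: its fibres have the size of a stabilizer,
  which the inverse weight cancels, and invariance of \<open>G\<close> makes the sum over
  \<open>w\<close> a factor \<open>fact n\<close>.\<close>

lemma sum_symmetric_PiE:
  fixes A :: "'a::linorder set" and G :: "(nat \<Rightarrow> 'a) \<Rightarrow> real"
  assumes A: "finite A"
    and G: "\<And>w t. w \<in> perm_group n \<Longrightarrow> G (t \<circ> w) = G t"
  defines "D \<equiv> {t \<in> {1..n} \<rightarrow>\<^sub>E A. decreasing_tuple n t}"
  shows "(\<Sum>t\<in>{1..n} \<rightarrow>\<^sub>E A. G t) = fact n * (\<Sum>t\<in>D. inverse (real (card (stab n t))) * G t)"
proof -
  let ?T = "{1..n} \<rightarrow>\<^sub>E A"
  have finT: "finite ?T" by (intro finite_PiE) (auto simp: A)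
  then have finD: "finite D" by (auto simp: D_def)
  \<comment> \<open>The fibre over \<open>t\<close> involves a single decreasing tuple
    \<open>m\<close>, paired with the coset of its stabilizer that carries \<open>m\<close> to
    \<open>t\<close>.\<close>
  have fib: "(\<Sum>(m,w)\<in>{x \<in> D \<times> perm_group n. fst x \<circ> snd x = t}.
      inverse (real (card (stab n m))) * G (m \<circ> w)) = G t" if t: "t \<in> ?T" for t
  proof -
    obtain v where v: "v \<in> perm_group n" "decreasing_tuple n (t \<circ> v)"
      using decreasing_rearrangement_exists by blast
    define m where "m = t \<circ> v"
    have vp: "v permutes {1..n}" using v by (simp add: perm_group_def)
    have iv: "inv v \<in> perm_group n" using vp by (simp add: perm_group_def permutes_inv)
    have mD: "m \<in> D" using v PiE_compose_perm[OF v(1) t] by (simp add: D_def m_def)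
    have tm: "t = m \<circ> inv v" by (simp add: m_def o_assoc[symmetric] permutes_inv_o[OF vp])
    have "m' = m" if "m' \<in> D" "w \<in> perm_group n" "m' \<circ> w = t" for m' w
    proof -
      have "m i = m' ((w \<circ> v) i)" for i using that(3) by (auto simp: m_def)
      moreover have "w \<circ> v \<in> perm_group n"
        using that(2) v by (simp add: perm_group_def permutes_compose)
      ultimately show ?thesis
        using decreasing_tuple_eqI[of m' n A m A] mD that(1) by (auto simp: D_def)
    qed
    then have set: "{x \<in> D \<times> perm_group n. fst x \<circ> snd x = t}
        = {m} \<times> {w \<in> perm_group n. m \<circ> w = m \<circ> inv v}"
      using mD tm by auto metis
    have "card {w \<in> perm_group n. m \<circ> w = m \<circ> inv v} = card (stab n m)"
      using card_rearrangements[OF iv, of m A] mD by (simp add: D_def)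
    moreover have "(\<Sum>w\<in>{w \<in> perm_group n. m \<circ> w = m \<circ> inv v}.
        inverse (real (card (stab n m))) * G (m \<circ> w))
      = (\<Sum>w\<in>{w \<in> perm_group n. m \<circ> w = m \<circ> inv v}. inverse (real (card (stab n m))) * G t)"
      by (rule sum.cong) (auto simp: tm)
    ultimately show ?thesis
      using stab_pos[of n m] unfolding set by (simp add: sum.cartesian_product[symmetric])
  qed
  have "fact n * (\<Sum>t\<in>D. inverse (real (card (stab n t))) * G t)
      = (\<Sum>t\<in>D. \<Sum>w\<in>perm_group n. inverse (real (card (stab n t))) * G (t \<circ> w))"
    by (simp add: G card_perm_group sum_distrib_left)
  also have "\<dots> = (\<Sum>(m,w)\<in>D \<times> perm_group n. inverse (real (card (stab n m))) * G (m \<circ> w))"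
    by (simp add: sum.cartesian_product)
  also have "\<dots> = (\<Sum>t\<in>?T. \<Sum>(m,w)\<in>{x \<in> D \<times> perm_group n. fst x \<circ> snd x = t}.
      inverse (real (card (stab n m))) * G (m \<circ> w))"
  proof (rule sum.group[symmetric])
    have "fst x \<circ> snd x \<in> ?T" if "x \<in> D \<times> perm_group n" for x
      by (rule PiE_compose_perm) (use that in \<open>auto simp: D_def\<close>)
    then show "(\<lambda>x. fst x \<circ> snd x) ` (D \<times> perm_group n) \<subseteq> ?T" by blast
  qed (use finT finD in simp_all)
  also have "\<dots> = (\<Sum>t\<in>?T. G t)" by (rule sum.cong) (use fib in auto)
  finally show ?thesis by simp
qed

section \<open>The kernel of the symmetrized cosine transform\<close>

lemma cos_plus_compose_perm:
  assumes "v \<in> perm_group n"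
  shows "cos_plus n (m \<circ> v) s = cos_plus n m s"
  using sum_perm_compose_left[OF assms, of "\<lambda>w. \<Prod>j=1..n. cos (pi * real_of_int (m (w j)) * s j)"]
  by (simp add: cos_plus_def)

lemma r_tuple_compose_perm:
  assumes "v \<in> perm_group n"
  shows "r_tuple N n (m \<circ> v) = r_tuple N n m"
  using prod_perm[OF assms, of "\<lambda>j. r_one N (m j)"] by (simp add: r_tuple_def)

text \<open>Reindexing each product by \<open>w\<close> moves the permutation from the labels
  \<open>m\<close> to the points \<open>s\<close> as its inverse, and inversion permutes the group.
  Having both forms lets the kernel be expanded on either side.\<close>

lemma cos_plus_permute_points:
  "cos_plus n m s = 1 / sqrt (fact n) *
     (\<Sum>w\<in>perm_group n. \<Prod>j=1..n. cos (pi * real_of_int (m j) * s (w j)))"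
proof -
  have "(\<Sum>w\<in>perm_group n. \<Prod>j=1..n. cos (pi * real_of_int (m (w j)) * s j))
      = (\<Sum>w\<in>perm_group n. \<Prod>j=1..n. cos (pi * real_of_int (m j) * s (inv w j)))"
  proof (rule sum.cong)
    fix w assume w: "w \<in> perm_group n"
    then have "inv w (w j) = j" for j
      by (auto simp: perm_group_def permutes_inverses)
    then show "(\<Prod>j=1..n. cos (pi * real_of_int (m (w j)) * s j))
      = (\<Prod>j=1..n. cos (pi * real_of_int (m j) * s (inv w j)))"
      using prod_perm[OF w, of "\<lambda>j. cos (pi * real_of_int (m j) * s (inv w j))"] by simp
  qed simp
  also have "\<dots> = (\<Sum>w\<in>perm_group n. \<Prod>j=1..n. cos (pi * real_of_int (m j) * s (w j)))"
    by (rule sum_perm_inv)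
  finally show ?thesis by (simp add: cos_plus_def card_perm_group)
qed

lemma cos_plus_kernel:
  assumes N: "N \<ge> 1" and s: "s \<in> {1..n} \<rightarrow>\<^sub>E grid N" and t: "t \<in> {1..n} \<rightarrow>\<^sub>E grid N"
  shows "(\<Sum>m\<in>{1..n} \<rightarrow>\<^sub>E {0..int N}. inverse (r_tuple N n m) * (cos_plus n m t * cos_plus n m s))
    = real N ^ n * inverse (c_tuple n t) * real (card {v \<in> perm_group n. \<forall>j\<in>{1..n}. t j = s (v j)})"
proof -
  let ?T = "{1..n} \<rightarrow>\<^sub>E {0..int N}"
  let ?P = "\<lambda>(m::nat \<Rightarrow> int) (s::nat \<Rightarrow> real). \<Prod>j=1..n. cos (pi * real_of_int (m j) * s j)"
  let ?R = "\<lambda>m. inverse (r_tuple N n m)"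
  let ?q = "1 / sqrt (fact n)"
  have "(\<Sum>m\<in>?T. ?R m * (cos_plus n m t * cos_plus n m s))
      = (\<Sum>m\<in>?T. \<Sum>w\<in>perm_group n. ?q * (?R m * ?P (m \<circ> w) t * cos_plus n m s))"
    by (simp add: cos_plus_def[of n _ t] card_perm_group sum_distrib_left sum_distrib_right mult_ac)
  also have "\<dots> = (\<Sum>w\<in>perm_group n. \<Sum>m\<in>?T. ?q * (?R m * ?P (m \<circ> w) t * cos_plus n m s))"
    by (rule sum.swap)
  \<comment> \<open>Replacing \<open>m\<close> by its rearrangement absorbs \<open>w\<close>, since
    the remaining factors are symmetric in \<open>m\<close>. All \<open>w\<close> thus contribute
    equally, giving a factor \<open>fact n\<close>.\<close>
  also have "\<dots> = (\<Sum>w\<in>perm_group n. \<Sum>m\<in>?T. ?q * (?R m * ?P m t * cos_plus n m s))"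
  proof (rule sum.cong)
    fix w assume w: "w \<in> perm_group n"
    show "(\<Sum>m\<in>?T. ?q * (?R m * ?P (m \<circ> w) t * cos_plus n m s))
      = (\<Sum>m\<in>?T. ?q * (?R m * ?P m t * cos_plus n m s))"
      using sum_PiE_compose_perm[OF w, of "\<lambda>m. ?q * (?R m * ?P m t * cos_plus n m s)" "{0..int N}"]
      by (simp only: cos_plus_compose_perm[OF w] r_tuple_compose_perm[OF w])
  qed simp
  also have "\<dots> = fact n * (\<Sum>m\<in>?T. ?q * (?R m * ?P m t * cos_plus n m s))"
    by (simp add: card_perm_group)
  \<comment> \<open>The second factor is expanded on the points, so that the label stays
    \<open>m j\<close> in both products and the summand factors over coordinates. The two square
    roots then cancel \<open>fact n\<close>.\<close>
  also have "\<dots> = fact n * (\<Sum>m\<in>?T. \<Sum>v\<in>perm_group n. ?q * ?q * (?R m * ?P m t * ?P m (s \<circ> v)))"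
    by (simp only: cos_plus_permute_points[of n _ s] o_apply sum_distrib_left mult_ac)
  also have "\<dots> = (\<Sum>m\<in>?T. \<Sum>v\<in>perm_group n. ?R m * ?P m t * ?P m (s \<circ> v))"
    by (simp add: sum_distrib_left)
  also have "\<dots> = (\<Sum>v\<in>perm_group n. \<Sum>m\<in>?T. ?R m * ?P m t * ?P m (s \<circ> v))"
    by (rule sum.swap)
  also have "\<dots> = (\<Sum>v\<in>perm_group n.
      if \<forall>j\<in>{1..n}. t j = s (v j) then real N ^ n * inverse (c_tuple n t) else 0)"
  proof (rule sum.cong)
    fix v assume v: "v \<in> perm_group n"
    then have sv: "s (v j) \<in> grid N" if "j \<in> {1..n}" for j
      using PiE_compose_perm[OF v s] that by (auto simp: PiE_iff)
    have "(\<Sum>m\<in>?T. ?R m * ?P m t * ?P m (s \<circ> v))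
      = (\<Sum>m\<in>?T. \<Prod>j=1..n. inverse (r_one N (m j)) *
          (cos (pi * real_of_int (m j) * t j) * cos (pi * real_of_int (m j) * s (v j))))"
      by (simp add: prod.distrib r_tuple_def prod_inversef[symmetric] o_def mult_ac)
    \<comment> \<open>Distributivity: a sum over all tuples of a coordinatewise product is a product
      of one-dimensional sums.\<close>
    also have "\<dots> = (\<Prod>j=1..n. \<Sum>m\<in>{0..int N}. inverse (r_one N m) *
          (cos (pi * real_of_int m * t j) * cos (pi * real_of_int m * s (v j))))"
      by (rule prod_sum_PiE[symmetric]) auto
    also have "\<dots> = (\<Prod>j=1..n. if t j = s (v j) then real N * inverse (c_one (t j)) else 0)"
      using t sv by (intro prod.cong cos_orthogonality[OF N] refl) (simp_all only: PiE_iff)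
    also have "\<dots> = (if \<forall>j\<in>{1..n}. t j = s (v j) then real N ^ n * inverse (c_tuple n t) else 0)"
    proof (cases "\<forall>j\<in>{1..n}. t j = s (v j)")
      case True
      then have "(\<Prod>j=1..n. if t j = s (v j) then real N * inverse (c_one (t j)) else 0)
        = (\<Prod>j=1..n. real N * inverse (c_one (t j)))"
        by (intro prod.cong) auto
      then show ?thesis using True
        by (simp add: prod.distrib c_tuple_def prod_inversef[symmetric] o_def)
    next
      case False
      then show ?thesis by (auto intro!: prod_zero)
    qed
    finally show "(\<Sum>m\<in>?T. ?R m * ?P m t * ?P m (s \<circ> v))
      = (if \<forall>j\<in>{1..n}. t j = s (v j) then real N ^ n * inverse (c_tuple n t) else 0)" .
  qed simp
  also have "\<dots> = real N ^ n * inverse (c_tuple n t) *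
      real (card {v \<in> perm_group n. \<forall>j\<in>{1..n}. t j = s (v j)})"
    by (simp add: sum.inter_filter[symmetric])
  finally show ?thesis .
qed

text \<open>Two decreasing tuples that are rearrangements of each other coincide, so the count of
  permutations carrying \<open>s\<close> to \<open>t\<close> is zero off the diagonal and the order
  of the stabilizer on it.\<close>

lemma cos_plus_kernel_decreasing:
  assumes N: "N \<ge> 1" and s: "s \<in> F_dom N n" and t: "t \<in> F_dom N n"
  shows "fact n * (\<Sum>m\<in>D_dom N n. inverse (real (card (stab n m))) *
      (inverse (r_tuple N n m) * (cos_plus n m t * cos_plus n m s)))
    = (if t = s then real N ^ n * inverse (c_tuple n s) * real (card (stab n s)) else 0)"
proof -
  have sT: "s \<in> {1..n} \<rightarrow>\<^sub>E grid N" and tT: "t \<in> {1..n} \<rightarrow>\<^sub>E grid N"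
    and ds: "decreasing_tuple n s" and dt: "decreasing_tuple n t"
    using s t by (auto simp: F_dom_def)
  have "fact n * (\<Sum>m\<in>D_dom N n. inverse (real (card (stab n m))) *
      (inverse (r_tuple N n m) * (cos_plus n m t * cos_plus n m s)))
    = (\<Sum>m\<in>{1..n} \<rightarrow>\<^sub>E {0..int N}. inverse (r_tuple N n m) * (cos_plus n m t * cos_plus n m s))"
    unfolding D_dom_def
    by (rule sum_symmetric_PiE[symmetric]) (simp_all add: r_tuple_compose_perm cos_plus_compose_perm)
  also have "\<dots> = real N ^ n * inverse (c_tuple n t) *
      real (card {v \<in> perm_group n. \<forall>j\<in>{1..n}. t j = s (v j)})"
    by (rule cos_plus_kernel[OF N sT tT])
  also have "\<dots> = (if t = s then real N ^ n * inverse (c_tuple n s) * real (card (stab n s)) else 0)"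
  proof (cases "t = s")
    case True
    then have "{v \<in> perm_group n. \<forall>j\<in>{1..n}. t j = s (v j)} = stab n s"
      by (auto simp: stab_def)
    then show ?thesis using True by simp
  next
    case False
    then have "{v \<in> perm_group n. \<forall>j\<in>{1..n}. t j = s (v j)} = {}"
      using decreasing_tuple_eqI[OF sT tT ds dt] by blast
    then show ?thesis using False by simp
  qed
  finally show ?thesis .
qed

section \<open>The inversion formula\<close>

theorem mainTheorem17:
  fixes n N :: nat and f :: "(nat \<Rightarrow> real) \<Rightarrow> real"
  assumes "n \<ge> 1" and "N \<ge> 1"
  shows "\<forall>s\<in>F_dom N n. f s = (\<Sum>m\<in>D_dom N n. coeff_a N n f m * cos_plus n m s)"
proof
  fix s assume s: "s \<in> F_dom N n"
  have "finite (grid N)" by (simp add: grid_def)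
  then have fin: "finite (F_dom N n)" by (simp add: F_dom_def finite_PiE)
  \<comment> \<open>\<open>?h t\<close> collects the factors free of \<open>m\<close>, so that after
    exchanging the sums the inner one is the kernel over decreasing labels.\<close>
  let ?h = "\<lambda>t. inverse (real N ^ n) * (inverse (real (card (stab n t))) * c_tuple n t * f t)"
  have "(\<Sum>m\<in>D_dom N n. coeff_a N n f m * cos_plus n m s)
    = (\<Sum>m\<in>D_dom N n. \<Sum>t\<in>F_dom N n. ?h t * (fact n * (inverse (real (card (stab n m))) *
      (inverse (r_tuple N n m) * (cos_plus n m t * cos_plus n m s)))))"
    by (simp add: coeff_a_def card_perm_group sum_distrib_left sum_distrib_right mult_ac)
  also have "\<dots> = (\<Sum>t\<in>F_dom N n. \<Sum>m\<in>D_dom N n. ?h t * (fact n * (inverse (real (card (stab n m))) *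
      (inverse (r_tuple N n m) * (cos_plus n m t * cos_plus n m s)))))"
    by (rule sum.swap)
  also have "\<dots> = (\<Sum>t\<in>F_dom N n. ?h t *
      (if t = s then real N ^ n * inverse (c_tuple n s) * real (card (stab n s)) else 0))"
    by (rule sum.cong)
       (simp_all only: sum_distrib_left[symmetric] cos_plus_kernel_decreasing[OF assms(2) s])
  also have "\<dots> = ?h s * (real N ^ n * inverse (c_tuple n s) * real (card (stab n s)))"
    using s fin by (simp add: if_distrib[of "\<lambda>x. _ * x"] cong: if_cong)
  also have "\<dots> = f s"
  proof -
    \<comment> \<open>Each factor is 1 or 1/2, so the weights in \<open>?h s\<close> are inverse to
      the diagonal value of the kernel.\<close>
    have "c_tuple n s \<noteq> 0" by (simp add: c_tuple_def c_one_def)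
    then show ?thesis using stab_pos[of n s] assms(2) by (simp add: field_simps)
  qed
  finally show "f s = (\<Sum>m\<in>D_dom N n. coeff_a N n f m * cos_plus n m s)" by simp
qed

end
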